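(* Let $(A,[-,-],\alpha)$ be a Hom-Maltsev algebra over $\mathbf{k}$. Then for each $n\ge 0$ the $n$th derived Hom-algebra $$A^n=(A,\;[-,-]^{(n)}=\alpha^{2^n-1}\circ[-,-],\;\alpha^{2^n})$$ is also a Hom-Maltsev algebra.
   Context: $\mathbf{k}$ is a fixed field of characteristic $0$; all modules, linear maps and tensor products are over $\mathbf{k}$. A Hom-algebra is a triple $(A,\mu,\alpha)$ with $A$ a $\mathbf{k}$-module, $\mu\colon A\otimes A\to A$ bilinear (not necessarily associative or unital), and $\alpha\colon A\to A$ linear with $\alpha(\mu(x,y))=\mu(\alpha(x),\alpha(y))$ for all $x,y$. For a Hom-algebra $(B,[-,-],\alpha)$, the Hom-Jacobian is $J_B(x,y,z)=[[x,y],\alpha(z)]+[[z,x],\alpha(y)]+[[y,z],\alpha(x)]$. A Hom-Maltsev algebra is a Hom-algebra $(B,[-,-],\alpha)$ with $[-,-]$ anti-symmetric and satisfying $J_B(\alpha(x),\alpha(y),[x,z])=[J_B(x,y,z),\alpha^2(x)]$ for all $x,y,z\in B$. Powers $\alpha^k$ denote $k$-fold composition, $\alpha^0=\mathrm{Id}$. *)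

theory Defs
  imports Complex_Main
begin

text \<open>
  The ground field is a type of class \<open>field_char_0\<close>; the underlying module \<open>A\<close> is a type
  with a scalar multiplication \<open>scale\<close>, in the style of the library locale \<open>vector_space\<close>.
  A linear map \<open>A \<otimes> A \<rightarrow> A\<close> is given as the corresponding bilinear map in curried form.
\<close>

locale hom_algebra = vector_space scale
  for scale :: "'k::field_char_0 \<Rightarrow> 'a::ab_group_add \<Rightarrow> 'a" +
  fixes mu :: "'a \<Rightarrow> 'a \<Rightarrow> 'a"
    and alpha :: "'a \<Rightarrow> 'a"
  assumes mu_linear_left: "\<And>y. Vector_Spaces.linear scale scale (\<lambda>x. mu x y)"
    and mu_linear_right: "\<And>x. Vector_Spaces.linear scale scale (\<lambda>y. mu x y)"
    and alpha_linear: "Vector_Spaces.linear scale scale alpha"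
    and alpha_multiplicative: "\<And>x y. alpha (mu x y) = mu (alpha x) (alpha y)"

definition hom_jacobian ::
    "('a::ab_group_add \<Rightarrow> 'a \<Rightarrow> 'a) \<Rightarrow> ('a \<Rightarrow> 'a) \<Rightarrow> 'a \<Rightarrow> 'a \<Rightarrow> 'a \<Rightarrow> 'a" where
  "hom_jacobian br alpha x y z =
     br (br x y) (alpha z) + br (br z x) (alpha y) + br (br y z) (alpha x)"

locale hom_maltsev_algebra = hom_algebra scale br alpha
  for scale :: "'k::field_char_0 \<Rightarrow> 'a::ab_group_add \<Rightarrow> 'a"
    and br :: "'a \<Rightarrow> 'a \<Rightarrow> 'a"
    and alpha :: "'a \<Rightarrow> 'a" +
  assumes antisymmetric: "\<And>x y. br x y = - br y x"
    and hom_maltsev_identity: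
      "\<And>x y z. hom_jacobian br alpha (alpha x) (alpha y) (br x z)
               = br (hom_jacobian br alpha x y z) ((alpha ^^ 2) x)"

definition derived_mult ::
    "('a \<Rightarrow> 'a \<Rightarrow> 'a) \<Rightarrow> ('a \<Rightarrow> 'a) \<Rightarrow> nat \<Rightarrow> 'a \<Rightarrow> 'a \<Rightarrow> 'a" where
  "derived_mult mu alpha n x y = (alpha ^^ (2 ^ n - 1)) (mu x y)"

definition derived_twist :: "('a \<Rightarrow> 'a) \<Rightarrow> nat \<Rightarrow> 'a \<Rightarrow> 'a" where
  "derived_twist alpha n = alpha ^^ (2 ^ n)"

end

theory Submission
  imports Defs
begin

text \<open>
  More generally, for every \<open>k\<close> the bracket \<open>\<alpha>\<^sup>k \<circ> [-,-]\<close> together with the map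
  \<open>\<alpha>\<^sup>k\<^sup>+\<^sup>1\<close> is again Hom-Maltsev; the derived algebra is the case \<open>k = 2\<^sup>n - 1\<close>.
  The reason is that \<open>\<alpha>\<^sup>k\<close> is a linear endomorphism of the bracket that commutes with \<open>\<alpha>\<close>,
  so it can be pulled out of an expression as soon as it acts equally often on every variable.
  The twisting map \<open>\<alpha>\<^sup>k\<^sup>+\<^sup>1\<close> is what makes it act equally often: in
  \<open>\<alpha>\<^sup>k[\<alpha>\<^sup>k[x,y], \<alpha>\<^sup>k\<^sup>+\<^sup>1 z]\<close> the inner bracket twists \<open>x\<close> and \<open>y\<close> by an additional \<open>\<alpha>\<^sup>k\<close>,
  and so does the map \<open>\<alpha>\<^sup>k\<^sup>+\<^sup>1 = \<alpha>\<^sup>k \<circ> \<alpha>\<close> with \<open>z\<close>. Hence the twisted Jacobian is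
  \<open>\<alpha>\<^sup>2\<^sup>k \<circ> J\<close>, and each side of the twisted Maltsev identity is \<open>\<alpha>\<^sup>3\<^sup>k\<close> applied to the
  corresponding side of the original identity.
\<close>

context hom_algebra
begin

lemma linear_alpha_funpow: "Vector_Spaces.linear scale scale (alpha ^^ k)"
proof (induction k)
  case 0
  show ?case
    using linear_id by (simp add: id_def)
next
  case (Suc k)
  then show ?case
    using Vector_Spaces.linear_compose[OF Suc alpha_linear] by (simp only: funpow.simps)
qed

lemma alpha_funpow_mult: "(alpha ^^ k) (mu x y) = mu ((alpha ^^ k) x) ((alpha ^^ k) y)"
  by (induction k) (simp_all add: alpha_multiplicative)

lemma alpha_funpow_add: "(alpha ^^ k) (x + y) = (alpha ^^ k) x + (alpha ^^ k) y"
  using linear_alpha_funpow[of k]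
  by (simp add: Vector_Spaces.linear_iff_module_hom module_hom.add)

lemma alpha_funpow_hom_jacobian:
  "(alpha ^^ k) (hom_jacobian mu alpha x y z)
     = hom_jacobian mu alpha ((alpha ^^ k) x) ((alpha ^^ k) y) ((alpha ^^ k) z)"
  by (simp add: hom_jacobian_def alpha_funpow_add alpha_funpow_mult funpow_swap1)

lemma hom_jacobian_twisted:
  "hom_jacobian (\<lambda>x y. (alpha ^^ k) (mu x y)) (alpha ^^ Suc k) x y z
     = (alpha ^^ (k + k)) (hom_jacobian mu alpha x y z)"
  by (simp add: hom_jacobian_def alpha_funpow_add alpha_funpow_mult funpow_add funpow_swap1)

lemma hom_algebra_twisted:
  "hom_algebra scale (\<lambda>x y. (alpha ^^ k) (mu x y)) (alpha ^^ Suc k)"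
proof (intro hom_algebra.intro hom_algebra_axioms.intro)
  show "vector_space scale"
    by (rule vector_space_axioms)
  show "Vector_Spaces.linear scale scale (\<lambda>x. (alpha ^^ k) (mu x y))" for y
    using Vector_Spaces.linear_compose[OF mu_linear_left linear_alpha_funpow] by (simp add: comp_def)
  show "Vector_Spaces.linear scale scale (\<lambda>y. (alpha ^^ k) (mu x y))" for x
    using Vector_Spaces.linear_compose[OF mu_linear_right linear_alpha_funpow] by (simp add: comp_def)
  show "Vector_Spaces.linear scale scale (alpha ^^ Suc k)"
    by (rule linear_alpha_funpow)
  show "(alpha ^^ Suc k) ((alpha ^^ k) (mu x y))
          = (alpha ^^ k) (mu ((alpha ^^ Suc k) x) ((alpha ^^ Suc k) y))" for x y
    by (simp add: alpha_funpow_mult alpha_multiplicative funpow_swap1)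
qed

end

context hom_maltsev_algebra
begin

lemma hom_maltsev_algebra_twisted:
  "hom_maltsev_algebra scale (\<lambda>x y. (alpha ^^ k) (br x y)) (alpha ^^ Suc k)"
proof (intro hom_maltsev_algebra.intro hom_algebra_twisted hom_maltsev_algebra_axioms.intro)
  fix x y z
  show "(alpha ^^ k) (br x y) = - (alpha ^^ k) (br y x)"
  proof -
    have "(alpha ^^ k) (br x y) = br ((alpha ^^ k) x) ((alpha ^^ k) y)"
      by (rule alpha_funpow_mult)
    also have "\<dots> = - br ((alpha ^^ k) y) ((alpha ^^ k) x)"
      by (rule antisymmetric)
    finally show ?thesis
      by (simp only: alpha_funpow_mult)
  qed
  let ?J = "hom_jacobian br alpha"
  let ?b = "\<lambda>x y. (alpha ^^ k) (br x y)"
  have "hom_jacobian ?b (alpha ^^ Suc k) ((alpha ^^ Suc k) x) ((alpha ^^ Suc k) y) (?b x z)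
      = (alpha ^^ (k + k)) (?J ((alpha ^^ k) (alpha x)) ((alpha ^^ k) (alpha y)) (?b x z))"
    unfolding hom_jacobian_twisted by (simp only: funpow_Suc_right comp_apply)
  also have "\<dots> = (alpha ^^ (k + k)) ((alpha ^^ k) (?J (alpha x) (alpha y) (br x z)))"
    by (simp only: alpha_funpow_hom_jacobian)
  also have "\<dots> = (alpha ^^ (k + k)) ((alpha ^^ k) (br (?J x y z) ((alpha ^^ 2) x)))"
    by (simp only: hom_maltsev_identity)
  also have "\<dots> = (alpha ^^ k) ((alpha ^^ (k + k)) (br (?J x y z) ((alpha ^^ 2) x)))"
    by (simp add: funpow_add)
  also have "\<dots> = ?b ((alpha ^^ (k + k)) (?J x y z)) ((alpha ^^ (k + k)) ((alpha ^^ 2) x))"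
    by (simp only: alpha_funpow_mult)
  also have "(alpha ^^ (k + k)) ((alpha ^^ 2) x) = ((alpha ^^ Suc k) ^^ 2) x"
  proof -
    have "(alpha ^^ (k + k)) ((alpha ^^ 2) x) = (alpha ^^ (k + k + 2)) x"
      by (simp only: funpow_add comp_apply)
    also have "k + k + 2 = Suc k * 2"
      by simp
    finally show ?thesis
      by (simp only: funpow_mult mult.commute)
  qed
  finally show "hom_jacobian ?b (alpha ^^ Suc k)
        ((alpha ^^ Suc k) x) ((alpha ^^ Suc k) y) (?b x z)
      = ?b (hom_jacobian ?b (alpha ^^ Suc k) x y z) (((alpha ^^ Suc k) ^^ 2) x)"
    by (simp only: hom_jacobian_twisted)
qed

end

theorem theorem2p11:
  fixes scale :: "'k::field_char_0 \<Rightarrow> 'a::ab_group_add \<Rightarrow> 'a"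
    and br :: "'a \<Rightarrow> 'a \<Rightarrow> 'a"
    and alpha :: "'a \<Rightarrow> 'a"
    and n :: nat
  assumes "hom_maltsev_algebra scale br alpha"
  shows "hom_maltsev_algebra scale (derived_mult br alpha n) (derived_twist alpha n)"
proof -
  have "derived_mult br alpha n = (\<lambda>x y. (alpha ^^ (2 ^ n - 1)) (br x y))"
    by (simp add: derived_mult_def fun_eq_iff)
  moreover have "derived_twist alpha n = alpha ^^ Suc (2 ^ n - 1)"
    by (simp add: derived_twist_def)
  ultimately show ?thesis
    using hom_maltsev_algebra.hom_maltsev_algebra_twisted[OF assms, of "2 ^ n - 1"] by simp
qed

end
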